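(* Let $n\geq 3$ be an integer and let $D_n=\{(i,j):1\leq i<j\leq n\}$. Then there is no collection $P=(p_1,\dots,p_n)$ of $n$ pairwise distinct points in $\mathbb{R}^{n-2}$ that induces a total preorder on $D_n$ in which $(n-1,n)$ is the unique minimal element and all the remaining pairs belong to a single, maximal, equivalence class.
   Context: A total preorder is a reflexive, transitive relation $\leq$ in which any two elements are comparable; $x\equiv y$ means $x\leq y$ and $y\leq x$, and $x<y$ means $x\leq y$ but not $y\leq x$. The relation $\equiv$ is an equivalence relation and $\leq$ induces a linear order on its classes. A collection $P=(p_1,\dots,p_n)$ of points in $\mathbb{R}^d$ (Euclidean norm) induces the total preorder on $D_n$ given by: $(i_1,i_2)\leq(j_1,j_2)$ if and only if $\|p_{i_1}-p_{i_2}\|\leq\|p_{j_1}-p_{j_2}\|$. So the preorder in question is the one with exactly two classes $\{(n-1,n)\}<D_n\setminus\{(n-1,n)\}$. *)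

theory Defs
  imports "HOL-Analysis.Analysis"
begin

definition index_pairs :: "nat \<Rightarrow> (nat \<times> nat) set" where
  "index_pairs n = {(i, j). 1 \<le> i \<and> i < j \<and> j \<le> n}"

(* For x = y comparability is part of reflexivity, so total_on, which only
   constrains distinct elements, suffices here. *)
definition total_preorder_on :: "'a set \<Rightarrow> 'a rel \<Rightarrow> bool" where
  "total_preorder_on A r \<longleftrightarrow> preorder_on A r \<and> total_on A r"

definition preorder_equiv :: "'a rel \<Rightarrow> 'a rel" where
  "preorder_equiv r = {(x, y). (x, y) \<in> r \<and> (y, x) \<in> r}"

definition preorder_strict :: "'a rel \<Rightarrow> 'a rel" where
  "preorder_strict r = {(x, y). (x, y) \<in> r \<and> (y, x) \<notin> r}"

definition minimal_elements :: "'a set \<Rightarrow> 'a rel \<Rightarrow> 'a set" where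
  "minimal_elements A r = {x \<in> A. \<not> (\<exists>y\<in>A. (y, x) \<in> preorder_strict r)}"

(* C is maximal among the equivalence classes: no class C' lies strictly above it
   in the order induced on the classes (the choice of representatives is immaterial). *)
definition maximal_class :: "'a set \<Rightarrow> 'a rel \<Rightarrow> 'a set \<Rightarrow> bool" where
  "maximal_class A r C \<longleftrightarrow>
     C \<in> A // preorder_equiv r \<and>
     \<not> (\<exists>C' \<in> A // preorder_equiv r. \<exists>x\<in>C. \<exists>y\<in>C'. (x, y) \<in> preorder_strict r)"

(* Only the values of p on {1..n} matter: p stands for the tuple (p 1, ..., p n). *)
definition induced_preorder :: "nat \<Rightarrow> (nat \<Rightarrow> 'a::metric_space) \<Rightarrow> (nat \<times> nat) rel" where
  "induced_preorder n p =
     {((i\<^sub>1, i\<^sub>2), (j\<^sub>1, j\<^sub>2)). (i\<^sub>1, i\<^sub>2) \<in> index_pairs n \<and> (j\<^sub>1, j\<^sub>2) \<in> index_pairs n \<and>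
        dist (p i\<^sub>1) (p i\<^sub>2) \<le> dist (p j\<^sub>1) (p j\<^sub>2)}"

lemma total_preorder_on_induced_preorder:
  "total_preorder_on (index_pairs n) (induced_preorder n p)"
  unfolding total_preorder_on_def preorder_on_def refl_on_def trans_def total_on_def
    induced_preorder_def
  by auto

end

theory Submission
  imports Defs
begin

text \<open>
  A realisation of this preorder would consist of \<open>n\<close> distinct points, two of which, \<open>a\<close> and \<open>b\<close>,
  are at some distance \<open>t > 0\<close>, while every other pair is at one common distance \<open>s \<ge> t\<close>. Such points
  are affinely independent in every inner product space, whereas \<open>n\<close> points of an \<open>n - 2\<close>-dimensional
  space never are.

  The independence comes from a linear system for the coefficients \<open>u v\<close> of a hypothetical
  affine dependence. The sum of \<open>u v * (dist v w)\<^sup>2\<close> over the points \<open>v\<close> is a number \<open>K\<close> that does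
  not depend on \<open>w\<close> (\<open>affine_relation_sum_dist_squared\<close>). Taking \<open>w\<close> to be the points themselves, where
  almost all distances equal \<open>s\<close>, determines each coefficient as \<open>- K\<close> times a positive number.
  The coefficients then all have the same sign and add up to zero, so they vanish
  (\<open>near_simplex_affine_independent\<close>).
\<close>

text \<open>
  Expanding \<open>(dist v w)\<^sup>2 = v \<bullet> v - 2 * (v \<bullet> w) + w \<bullet> w\<close>, the two conditions on the coefficients
  annihilate exactly the terms that contain \<open>w\<close>.
\<close>

lemma affine_relation_sum_dist_squared:
  fixes u :: "'a::real_inner \<Rightarrow> real"
  assumes "sum u S = 0" and "(\<Sum>v\<in>S. u v *\<^sub>R v) = 0"
  shows "(\<Sum>v\<in>S. u v * (dist v w)\<^sup>2) = (\<Sum>v\<in>S. u v * (v \<bullet> v))"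
proof -
  have "(\<Sum>v\<in>S. u v * (dist v w)\<^sup>2)
      = (\<Sum>v\<in>S. u v * (v \<bullet> v) - 2 * (u v *\<^sub>R v \<bullet> w) + u v * (w \<bullet> w))"
    by (rule sum.cong)
       (simp_all add: dist_norm power2_norm_eq_inner inner_diff inner_commute algebra_simps)
  also have "\<dots> = (\<Sum>v\<in>S. u v * (v \<bullet> v)) - 2 * ((\<Sum>v\<in>S. u v *\<^sub>R v) \<bullet> w) + sum u S * (w \<bullet> w)"
    by (simp only: sum.distrib sum_subtractf inner_sum_left sum_distrib_left sum_distrib_right)
  finally show ?thesis
    using assms by simp
qed

text \<open>
  A regular simplex may have one edge shortened, or lengthened by a factor below \<open>sqrt 2\<close>, without
  becoming degenerate. The bound is what makes the coefficient \<open>2 * s\<^sup>2 - t\<^sup>2\<close> positive in the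
  equation \<open>(2 * s\<^sup>2 - t\<^sup>2) * u a = - K\<close>, and hence gives \<open>u a\<close> the sign of the other coefficients.
\<close>

lemma near_simplex_affine_independent:
  fixes S :: "'a::real_inner set"
  assumes "finite S" and "a \<in> S" and "b \<in> S" and "a \<noteq> b"
    and "s \<noteq> 0" and short: "(dist a b)\<^sup>2 < 2 * s\<^sup>2"
    and sides: "\<And>v w. v \<in> S \<Longrightarrow> w \<in> S \<Longrightarrow> v \<noteq> w \<Longrightarrow> {v, w} \<noteq> {a, b} \<Longrightarrow> dist v w = s"
  shows "\<not> affine_dependent S"
proof
  assume "affine_dependent S"
  then obtain u where sum0: "sum u S = 0" and nz: "\<exists>v\<in>S. u v \<noteq> 0"
      and vec0: "(\<Sum>v\<in>S. u v *\<^sub>R v) = 0"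
    using affine_dependent_explicit_finite[OF \<open>finite S\<close>] by blast
  define K where "K = (\<Sum>v\<in>S. u v * (v \<bullet> v))"
  define t where "t = dist a b"
  have K: "(\<Sum>v\<in>S. u v * (dist v w)\<^sup>2) = K" for w
    unfolding K_def by (rule affine_relation_sum_dist_squared[OF sum0 vec0])
  have s2: "s\<^sup>2 > 0" and t2: "t\<^sup>2 > 0" and ts: "2 * s\<^sup>2 - t\<^sup>2 > 0"
    using \<open>s \<noteq> 0\<close> \<open>a \<noteq> b\<close> short by (auto simp: t_def)

  have other: "s\<^sup>2 * u w = - K" if w: "w \<in> S" "w \<noteq> a" "w \<noteq> b" for w
  proof -
    have "K = (\<Sum>v\<in>S. s\<^sup>2 * u v - (if v = w then s\<^sup>2 * u w else 0))"
      unfolding K[of w, symmetric]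
      by (rule sum.cong) (use w sides in \<open>auto simp: doubleton_eq_iff\<close>)
    also have "\<dots> = s\<^sup>2 * sum u S - s\<^sup>2 * u w"
      using w \<open>finite S\<close> by (simp add: sum_subtractf sum_distrib_left)
    finally show ?thesis
      using sum0 by simp
  qed
  have apex: "s\<^sup>2 * u x + (s\<^sup>2 - t\<^sup>2) * u y = - K" if xy: "{x, y} = {a, b}" for x y
  proof -
    have x: "x \<in> S" "y \<in> S" "x \<noteq> y" "dist y x = t"
      using xy assms(2-4) by (auto simp: doubleton_eq_iff t_def dist_commute)
    have "K = (\<Sum>v\<in>S. s\<^sup>2 * u v - (if v = x then s\<^sup>2 * u x else 0)
                        - (if v = y then (s\<^sup>2 - t\<^sup>2) * u y else 0))"
      unfolding K[of x, symmetric]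
    proof (rule sum.cong[OF refl])
      fix v assume "v \<in> S"
      moreover have "dist v x = s" if "v \<noteq> x" "v \<noteq> y"
        using sides[of v x] \<open>v \<in> S\<close> x that xy by (auto simp: doubleton_eq_iff)
      ultimately show "u v * (dist v x)\<^sup>2 = s\<^sup>2 * u v - (if v = x then s\<^sup>2 * u x else 0)
                        - (if v = y then (s\<^sup>2 - t\<^sup>2) * u y else 0)"
        using x by (cases "v = x"; cases "v = y") (auto simp: algebra_simps)
    qed
    also have "\<dots> = s\<^sup>2 * sum u S - s\<^sup>2 * u x - (s\<^sup>2 - t\<^sup>2) * u y"
      using x \<open>finite S\<close> by (simp add: sum_subtractf sum_distrib_left)
    finally show ?thesis
      using sum0 by simp
  qed
  \<comment> \<open>Subtracting the equations at \<open>a\<close> and at \<open>b\<close> leaves \<open>t\<^sup>2 * (u a - u b) = 0\<close>.\<close>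
  have "t\<^sup>2 * (u a - u b) = 0"
    using apex[of a b] apex[of b a] by (auto simp: algebra_simps insert_commute)
  then have "u a = u b"
    using t2 by simp
  then have ab: "(2 * s\<^sup>2 - t\<^sup>2) * u x = - K" if "x \<in> {a, b}" for x
    using apex[of a b] that by (auto simp: algebra_simps)

  have coeff: "\<exists>c>0. c * u v = - K" if "v \<in> S" for v
  proof (cases "v \<in> {a, b}")
    case True
    then show ?thesis
      using ab[of v] ts by blast
  next
    case False
    then show ?thesis
      using other[of v] that s2 by blast
  qed
  have "0 \<le> - K * u v" if "v \<in> S" for v
  proof -
    obtain c where c: "c > 0" "c * u v = - K"
      using coeff[OF \<open>v \<in> S\<close>] by blast
    have "- K * u v = c * (u v)\<^sup>2"
      unfolding c(2)[symmetric] by (simp add: power2_eq_square)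
    then show ?thesis
      using c(1) by simp
  qed
  moreover have "(\<Sum>v\<in>S. - K * u v) = 0"
    by (simp only: sum_distrib_left[symmetric] sum0 mult_zero_right)
  ultimately have "- K * u a = 0"
    using \<open>finite S\<close> \<open>a \<in> S\<close> sum_nonneg_eq_0_iff[of S "\<lambda>v. - K * u v"] by blast
  then have "K = 0"
    using coeff[OF \<open>a \<in> S\<close>] by auto
  then have "u v = 0" if "v \<in> S" for v
    using coeff[OF that] by auto
  then show False
    using nz by blast
qed

theorem proposition6:
  fixes n :: nat
  assumes "n \<ge> 3" and "CARD('d::finite) = n - 2"
  shows "\<not> (\<exists>(p :: nat \<Rightarrow> real ^ 'd) r.
            inj_on p {1..n} \<and>
            total_preorder_on (index_pairs n) r \<and>
            r = induced_preorder n p \<and>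
            minimal_elements (index_pairs n) r = {(n - 1, n)} \<and>
            (\<exists>C. maximal_class (index_pairs n) r C \<and> index_pairs n - {(n - 1, n)} \<subseteq> C))"
proof
  assume "\<exists>(p :: nat \<Rightarrow> real ^ 'd) r.
            inj_on p {1..n} \<and>
            total_preorder_on (index_pairs n) r \<and>
            r = induced_preorder n p \<and>
            minimal_elements (index_pairs n) r = {(n - 1, n)} \<and>
            (\<exists>C. maximal_class (index_pairs n) r C \<and> index_pairs n - {(n - 1, n)} \<subseteq> C)"
  then obtain p :: "nat \<Rightarrow> real ^ 'd" and r C where
      inj: "inj_on p {1..n}" and
      r: "r = induced_preorder n p" and
      min: "minimal_elements (index_pairs n) r = {(n - 1, n)}" and
      max: "maximal_class (index_pairs n) r C" and
      sub: "index_pairs n - {(n - 1, n)} \<subseteq> C"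
    by (elim exE conjE)
  have cls: "C \<in> index_pairs n // preorder_equiv r"
    using max by (simp add: maximal_class_def)
  \<comment> \<open>For \<open>n \<ge> 3\<close> the pair \<open>(1, n)\<close> differs from \<open>(n - 1, n)\<close>, so it can stand for the upper class.\<close>
  define s where "s = dist (p 1) (p n)"
  have side: "dist (p i) (p j) = s" if "1 \<le> i" "i < j" "j \<le> n" "(i, j) \<noteq> (n - 1, n)" for i j
  proof -
    have "(i, j) \<in> C" "(1, n) \<in> C"
      using sub that \<open>n \<ge> 3\<close> by (auto simp: index_pairs_def)
    moreover obtain z where "C = preorder_equiv r `` {z}"
      using cls by (rule quotientE)
    ultimately show ?thesis
      by (cases z) (auto simp: r preorder_equiv_def induced_preorder_def s_def)
  qed
  have "(n - 1, n) \<in> minimal_elements (index_pairs n) r"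
    using min by simp
  moreover have "(1, n) \<in> index_pairs n" "(n - 1, n) \<in> index_pairs n"
    using \<open>n \<ge> 3\<close> by (auto simp: index_pairs_def)
  ultimately have le: "dist (p (n - 1)) (p n) \<le> s"
    unfolding r minimal_elements_def preorder_strict_def induced_preorder_def s_def by fastforce
  have "p 1 \<noteq> p n" and ne: "p (n - 1) \<noteq> p n"
    using inj \<open>n \<ge> 3\<close> by (auto dest: inj_onD)
  then have s: "s > 0"
    by (simp add: s_def)
  have short: "(dist (p (n - 1)) (p n))\<^sup>2 < 2 * s\<^sup>2"
  proof -
    have "(dist (p (n - 1)) (p n))\<^sup>2 \<le> s\<^sup>2"
      using le by (simp add: power_mono)
    also have "\<dots> < 2 * s\<^sup>2"
      using s by simp
    finally show ?thesis .
  qed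
  have "\<not> affine_dependent (p ` {1..n})"
  proof (rule near_simplex_affine_independent[where a = "p (n - 1)" and b = "p n" and s = s])
    fix v w
    assume "v \<in> p ` {1..n}" "w \<in> p ` {1..n}" and vw: "v \<noteq> w" "{v, w} \<noteq> {p (n - 1), p n}"
    then obtain i j where ij: "i \<in> {1..n}" "v = p i" "j \<in> {1..n}" "w = p j"
      by blast
    with vw have "i \<noteq> j" "(i, j) \<noteq> (n - 1, n)" "(j, i) \<noteq> (n - 1, n)"
      by auto
    with ij show "dist v w = s"
      using side[of i j] side[of j i] by (cases "i < j") (auto simp: dist_commute)
  qed (use \<open>n \<ge> 3\<close> ne s short in auto)
  moreover have "affine_dependent (p ` {1..n})"
    using assms inj by (intro affine_dependent_biggerset) (auto simp: card_image)
  ultimately show False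
    by blast
qed

end
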